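(* Let $q=\exp(2\pi i/3)$, let $T=(T_{ijk})_{i,j,k\in\{1,2,3\}}$ be an arbitrary complex third-order hypermatrix, let $u=(u^A),v=(v^A)\in\mathbb C^5$, and let $U=T(u)$, $V=T(v)$ be the traceless $q$-cyclic hypermatrices with coordinates $u$ and $v$. Then $$(T\diamond U\diamond V)_{ijk}=\sum_{p=1}^3 T_{ijp}\,H_{pk},$$ where the $3\times 3$ matrix $H=(H_{pk})$, $H_{pk}=\sum_{r,s=1}^3U_{rsp}V_{srk}$, is given as follows. For each $p\in\{1,2,3\}$ (no summation over $p$), $$H_{pp}=\frac q3\,K(u,v),\qquad K(u,v)=u^1v^1+u^2v^2+u^3v^3+q\,u^4v^5+q\,u^5v^4,$$ and for $p\neq k$, $$H_{pk}=\frac q6\begin{vmatrix}u^k&u^p\\ v^k&v^p\end{vmatrix}+\frac{1}{3\sqrt2}\sum_{r=1}^3\tau_{pkr}\begin{vmatrix}u^r&u^4\\ v^r&v^4\end{vmatrix}+\frac{1}{3\sqrt2}\sum_{r=1}^3\bar\tau_{pkr}\begin{vmatrix}u^r&u^5\\ v^r&v^5\end{vmatrix}.$$ In particular $H_{pk}=-H_{kp}$ for $p\neq k$, so the symmetric part of $H$ is its diagonal part, determined by the bilinear form $K(u,v)$, and the skew-symmetric part of $H$ is its off-diagonal part.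
   Context: The ternary multiplication of hypermatrices is $(T\diamond U\diamond V)_{ijk}=\sum_{p,r,s=1}^3 T_{ijp}\,U_{rsp}\,V_{srk}$. A hypermatrix is traceless if the trace over any pair of its indices vanishes, and $q$-cyclic if $T_{ijk}=q\,T_{jki}$ for all $i,j,k$. For $z=(z^1,\dots,z^5)\in\mathbb C^5$ (superscripts are coordinate labels, not powers), $T(z)$ denotes the traceless $q$-cyclic hypermatrix whose three slices $(T(z)_{ijk})_{j,k}$ ($j$ = row, $k$ = column) are, for $i=1,2,3$ respectively, $$\begin{pmatrix}0&-\frac{\bar q z^2}{\sqrt6}&\frac{\bar q z^3}{\sqrt6}\\-\frac{q z^2}{\sqrt6}&\frac{z^1}{\sqrt6}&\frac{z^4}{\sqrt3}\\ \frac{q z^3}{\sqrt6}&\frac{q z^5}{\sqrt3}&-\frac{z^1}{\sqrt6}\end{pmatrix},\quad \begin{pmatrix}-\frac{z^2}{\sqrt6}&\frac{q z^1}{\sqrt6}&\frac{\bar q z^5}{\sqrt3}\\ \frac{\bar q z^1}{\sqrt6}&0&-\frac{\bar q z^3}{\sqrt6}\\ \frac{\bar q z^4}{\sqrt3}&-\frac{q z^3}{\sqrt6}&\frac{z^2}{\sqrt6}\end{pmatrix},\quad \begin{pmatrix}\frac{z^3}{\sqrt6}&\frac{q z^4}{\sqrt3}&-\frac{q z^1}{\sqrt6}\\ \frac{z^5}{\sqrt3}&-\frac{z^3}{\sqrt6}&\frac{q z^2}{\sqrt6}\\-\frac{\bar q z^1}{\sqrt6}&\frac{\bar q z^2}{\sqrt6}&0\end{pmatrix}.$$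 The map $z\mapsto T(z)$ is a linear isomorphism from $\mathbb C^5$ onto the space of traceless $q$-cyclic hypermatrices. The hypermatrix $\tau=(\tau_{ijk})$ is defined by $\tau_{123}=\bar q$, $\tau_{231}=q$, $\tau_{312}=1$, $\tau_{213}=-\bar q$, $\tau_{321}=-q$, $\tau_{132}=-1$, and $\tau_{ijk}=0$ if at least two of $i,j,k$ are equal; $\bar\tau_{ijk}$ is the complex conjugate of $\tau_{ijk}$. Vertical bars denote $2\times2$ determinants. *)

theory Defs
  imports "HOL-Analysis.Analysis"
begin

text \<open>
  The entry of a hypermatrix \<open>T\<close> at position \<open>ijk\<close> is \<open>T $ i $ j $ k\<close>. The index types \<open>3\<close> and \<open>5\<close>
  are modular, so the last index \<open>3\<close> (resp. \<open>5\<close>) coincides with \<open>0\<close>; we only ever use the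
  names \<open>1, 2, 3\<close> and \<open>1, \<dots>, 5\<close>.
\<close>

type_synonym hypermatrix = "complex ^ 3 ^ 3 ^ 3"

definition q3 :: complex where
  "q3 = exp (2 * of_real pi * \<i> / 3)"

definition hmult :: "hypermatrix \<Rightarrow> hypermatrix \<Rightarrow> hypermatrix \<Rightarrow> hypermatrix" where
  "hmult T U V = (\<chi> i j k. \<Sum>p\<in>UNIV. \<Sum>r\<in>UNIV. \<Sum>s\<in>UNIV.
      T $ i $ j $ p * U $ r $ s $ p * V $ s $ r $ k)"

definition traceless :: "hypermatrix \<Rightarrow> bool" where
  "traceless T \<longleftrightarrow> (\<forall>k. (\<Sum>i\<in>UNIV. T $ i $ i $ k) = 0 \<and>
                       (\<Sum>i\<in>UNIV. T $ i $ k $ i) = 0 \<and>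
                       (\<Sum>i\<in>UNIV. T $ k $ i $ i) = 0)"

definition q_cyclic :: "hypermatrix \<Rightarrow> bool" where
  "q_cyclic T \<longleftrightarrow> (\<forall>i j k. T $ i $ j $ k = q3 * T $ j $ k $ i)"

definition hyp :: "complex ^ 5 \<Rightarrow> hypermatrix" where
  "hyp z = (let q = q3; q' = cnj q3; s6 = of_real (sqrt 6); s3 = of_real (sqrt 3) in
     vector
      [vector
        [vector [0, - (q' * z$2 / s6), q' * z$3 / s6],
         vector [- (q * z$2 / s6), z$1 / s6, z$4 / s3],
         vector [q * z$3 / s6, q * z$5 / s3, - (z$1 / s6)]],
       vector
        [vector [- (z$2 / s6), q * z$1 / s6, q' * z$5 / s3],
         vector [q' * z$1 / s6, 0, - (q' * z$3 / s6)],
         vector [q' * z$4 / s3, - (q * z$3 / s6), z$2 / s6]],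
       vector
        [vector [z$3 / s6, q * z$4 / s3, - (q * z$1 / s6)],
         vector [z$5 / s3, - (z$3 / s6), q * z$2 / s6],
         vector [- (q' * z$1 / s6), q' * z$2 / s6, 0]]])"

definition tau :: hypermatrix where
  "tau = (\<chi> i j k.
     if (i, j, k) = (1, 2, 3) then cnj q3
     else if (i, j, k) = (2, 3, 1) then q3
     else if (i, j, k) = (3, 1, 2) then 1
     else if (i, j, k) = (2, 1, 3) then - cnj q3
     else if (i, j, k) = (3, 2, 1) then - q3
     else if (i, j, k) = (1, 3, 2) then - 1
     else 0)"

definition K :: "complex ^ 5 \<Rightarrow> complex ^ 5 \<Rightarrow> complex" where
  "K u v = u$1 * v$1 + u$2 * v$2 + u$3 * v$3 + q3 * u$4 * v$5 + q3 * u$5 * v$4"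

text \<open>The coordinates \<open>z$1, z$2, z$3\<close>, indexed by hypermatrix indices.\<close>

definition first3 :: "complex ^ 5 \<Rightarrow> complex ^ 3" where
  "first3 z = vector [z$1, z$2, z$3]"

definition det2 :: "complex \<Rightarrow> complex \<Rightarrow> complex \<Rightarrow> complex \<Rightarrow> complex" where
  "det2 a b c d = det (vector [vector [a, b], vector [c, d]] :: complex ^ 2 ^ 2)"

definition sym_part :: "complex ^ 3 ^ 3 \<Rightarrow> complex ^ 3 ^ 3" where
  "sym_part M = (1 / 2) *\<^sub>R (M + transpose M)"

definition skew_part :: "complex ^ 3 ^ 3 \<Rightarrow> complex ^ 3 ^ 3" where
  "skew_part M = (1 / 2) *\<^sub>R (M - transpose M)"

definition diag_part :: "complex ^ 3 ^ 3 \<Rightarrow> complex ^ 3 ^ 3" where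
  "diag_part M = (\<chi> p k. if p = k then M $ p $ k else 0)"

definition offdiag_part :: "complex ^ 3 ^ 3 \<Rightarrow> complex ^ 3 ^ 3" where
  "offdiag_part M = (\<chi> p k. if p = k then 0 else M $ p $ k)"

lemma q3_eq: "q3 = Complex (- 1 / 2) (sqrt 3 / 2)"
proof -
  have "q3 = cis (2 * pi / 3)"
    by (simp add: q3_def cis_conv_exp mult_ac)
  then show ?thesis
    by (simp add: cis.ctr cos_120 sin_120)
qed

lemma q3_mult:
  "q3 * cnj q3 = 1" "cnj q3 * q3 = 1" "q3 * q3 = cnj q3" "cnj q3 * cnj q3 = q3"
  "q3 * (cnj q3 * x) = x" "cnj q3 * (q3 * x) = x"
  "q3 * (q3 * x) = cnj q3 * x" "cnj q3 * (cnj q3 * x) = q3 * x"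
proof -
  show 1: "q3 * cnj q3 = 1" "cnj q3 * q3 = 1" "q3 * q3 = cnj q3" "cnj q3 * cnj q3 = q3"
    by (simp_all add: q3_eq complex_eq_iff)
  show "q3 * (cnj q3 * x) = x" "cnj q3 * (q3 * x) = x"
    "q3 * (q3 * x) = cnj q3 * x" "cnj q3 * (cnj q3 * x) = q3 * x"
    by (simp_all add: 1 mult.assoc[symmetric])
qed

lemma q3_sum: "1 + q3 + cnj q3 = 0"
  by (simp add: q3_eq complex_eq_iff)

lemma traceless_hyp: "traceless (hyp z)"
  by (simp add: traceless_def hyp_def Let_def forall_3 sum_3)

lemma q_cyclic_hyp: "q_cyclic (hyp z)"
  by (simp add: q_cyclic_def hyp_def Let_def forall_3 q3_mult)

lemma hyp_add: "hyp (x + y) = hyp x + hyp y"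
  by (simp add: hyp_def Let_def vec_eq_iff forall_3 add_divide_distrib ring_distribs)

lemma hyp_scale: "hyp (c *s z) $ i $ j $ k = c * hyp z $ i $ j $ k"
proof -
  have "\<forall>i j k. hyp (c *s z) $ i $ j $ k = c * hyp z $ i $ j $ k"
    by (simp add: hyp_def Let_def forall_3 mult_ac)
  then show ?thesis by blast
qed

lemma exhaust_5: "x = 1 \<or> x = 2 \<or> x = 3 \<or> x = 4 \<or> x = 5" for x :: 5
proof (induct x)
  case (of_int z)
  then have "0 \<le> z" and "z < 5" by simp_all
  then have "z = 0 \<or> z = 1 \<or> z = 2 \<or> z = 3 \<or> z = 4" by arith
  then show ?case by auto
qed

lemma forall_5: "(\<forall>i::5. P i) \<longleftrightarrow> P 1 \<and> P 2 \<and> P 3 \<and> P 4 \<and> P 5"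
  by (metis exhaust_5)

theorem bij_betw_hyp: "bij_betw hyp UNIV {T. traceless T \<and> q_cyclic T}"
proof -
  have "inj hyp"
  proof (rule injI)
    fix x y assume "hyp x = hyp y"
    then have "hyp x $ i $ j $ k = hyp y $ i $ j $ k" for i j k by simp
    from this[of 1 2 2] this[of 2 1 1] this[of 3 1 1] this[of 1 2 3] this[of 3 2 1]
    show "x = y" by (simp add: hyp_def Let_def vec_eq_iff forall_5)
  qed
  moreover have "T \<in> range hyp" if tr: "traceless T" and cy: "q_cyclic T" for T
  proof -
    define z :: "complex ^ 5" where "z = (\<chi> A.
      if A = 1 then of_real (sqrt 6) * T$1$2$2
      else if A = 2 then - (of_real (sqrt 6) * T$2$1$1)
      else if A = 3 then of_real (sqrt 6) * T$3$1$1
      else if A = 4 then of_real (sqrt 3) * T$1$2$3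
      else of_real (sqrt 3) * T$3$2$1)"
    have z: "z$1 = of_real (sqrt 6) * T$1$2$2" "z$2 = - (of_real (sqrt 6) * T$2$1$1)"
      "z$3 = of_real (sqrt 6) * T$3$1$1" "z$4 = of_real (sqrt 3) * T$1$2$3"
      "z$5 = of_real (sqrt 3) * T$3$2$1"
      by (simp_all add: z_def)
    have c: "T$j$k$i = cnj q3 * T$i$j$k" for i j k
      using cy unfolding q_cyclic_def by (metis q3_mult(6))
    have q1: "q3 \<noteq> 1" by (simp add: q3_eq complex_eq_iff)
    have d: "T$i$i$i = 0" for i
    proof -
      have "T$i$i$i = q3 * T$i$i$i" using cy unfolding q_cyclic_def by blast
      then show ?thesis using q1 by (metis mult_cancel_right1)
    qed
    have t: "(\<Sum>i\<in>UNIV. T $ k $ i $ i) = 0" for k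
      using tr unfolding traceless_def by blast
    have e: "T$1$3$3 = - T$1$2$2" "T$2$3$3 = - T$2$1$1" "T$3$2$2 = - T$3$1$1"
      using t[of 1] t[of 2] t[of 3] by (simp_all add: sum_3 d add_eq_0_iff)
    have f: "T$2$2$1 = cnj q3 * T$1$2$2" "T$2$1$2 = q3 * T$1$2$2"
      "T$3$3$1 = - (cnj q3 * T$1$2$2)" "T$3$1$3 = - (q3 * T$1$2$2)"
      "T$1$1$2 = cnj q3 * T$2$1$1" "T$1$2$1 = q3 * T$2$1$1"
      "T$3$3$2 = - (cnj q3 * T$2$1$1)" "T$3$2$3 = - (q3 * T$2$1$1)"
      "T$1$1$3 = cnj q3 * T$3$1$1" "T$1$3$1 = q3 * T$3$1$1"
      "T$2$2$3 = - (cnj q3 * T$3$1$1)" "T$2$3$2 = - (q3 * T$3$1$1)"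
      "T$2$3$1 = cnj q3 * T$1$2$3" "T$3$1$2 = q3 * T$1$2$3"
      "T$2$1$3 = cnj q3 * T$3$2$1" "T$1$3$2 = q3 * T$3$2$1"
      using c[where j=2 and k=2 and i=1] c[where j=2 and k=1 and i=2]
        c[where j=3 and k=3 and i=1] c[where j=3 and k=1 and i=3]
        c[where j=1 and k=1 and i=2] c[where j=1 and k=2 and i=1]
        c[where j=3 and k=3 and i=2] c[where j=3 and k=2 and i=3]
        c[where j=1 and k=1 and i=3] c[where j=1 and k=3 and i=1]
        c[where j=2 and k=2 and i=3] c[where j=2 and k=3 and i=2]
        c[where j=2 and k=3 and i=1] c[where j=3 and k=1 and i=2]
        c[where j=2 and k=1 and i=3] c[where j=1 and k=3 and i=2]
      by (simp_all only: e mult_minus_right q3_mult)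
    have "hyp z = T"
      by (simp add: hyp_def Let_def vec_eq_iff forall_3 z d e f)
    then show ?thesis by blast
  qed
  ultimately show ?thesis
    using traceless_hyp q_cyclic_hyp by (auto simp: bij_betw_def)
qed

theorem linear_K:
  "Vector_Spaces.linear (*s) (*) (K u)"
  "Vector_Spaces.linear (*s) (*) (\<lambda>u. K u v)"
  by (unfold_locales; simp add: K_def algebra_simps)+

end

theory Submission
  imports Defs
begin

text \<open>Replacing division by the square roots with multiplication by constants makes every
  entry a polynomial, so identities between products of entries can be decided by ring
  normalisation.\<close>

lemma hyp_as_multiples:
  fixes z :: "complex ^ 5"
  defines "a \<equiv> 1 / of_real (sqrt 6)" and "b \<equiv> 1 / of_real (sqrt 3)"
  shows "hyp z = vector
      [vector
        [vector [0, - (cnj q3 * a * z$2), cnj q3 * a * z$3],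
         vector [- (q3 * a * z$2), a * z$1, b * z$4],
         vector [q3 * a * z$3, q3 * b * z$5, - (a * z$1)]],
       vector
        [vector [- (a * z$2), q3 * a * z$1, cnj q3 * b * z$5],
         vector [cnj q3 * a * z$1, 0, - (cnj q3 * a * z$3)],
         vector [cnj q3 * b * z$4, - (q3 * a * z$3), a * z$2]],
       vector
        [vector [a * z$3, q3 * b * z$4, - (q3 * a * z$1)],
         vector [b * z$5, - (a * z$3), q3 * a * z$2],
         vector [- (cnj q3 * a * z$1), cnj q3 * a * z$2, 0]]]"
  by (simp add: hyp_def Let_def a_def b_def)

lemma slice_product_entries:
  fixes u v :: "complex ^ 5" and H :: "complex ^ 3 ^ 3"
  assumes H: "H = (\<chi> p k. \<Sum>r\<in>UNIV. \<Sum>s\<in>UNIV. hyp u $ r $ s $ p * hyp v $ s $ r $ k)"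
  shows "H $ p $ p = q3 / 3 * K u v"
    and "p \<noteq> k \<Longrightarrow> H $ p $ k =
           q3 / 6 * det2 (first3 u $ k) (first3 u $ p) (first3 v $ k) (first3 v $ p)
           + 1 / (3 * of_real (sqrt 2)) *
             (\<Sum>r\<in>UNIV. tau $ p $ k $ r * det2 (first3 u $ r) (u $ 4) (first3 v $ r) (v $ 4))
           + 1 / (3 * of_real (sqrt 2)) *
             (\<Sum>r\<in>UNIV. cnj (tau $ p $ k $ r) * det2 (first3 u $ r) (u $ 5) (first3 v $ r) (v $ 5))"
proof -
  \<comment> \<open>Since \<open>1 / sqrt 3 = w a\<close>, both sides are \<open>a\<^sup>2\<close> times integer polynomials in \<open>w\<close>, \<open>q3\<close> and
    the coordinates, which agree modulo \<open>w\<^sup>2 = 2\<close> and \<open>q3\<^sup>2 = - 1 - q3\<close>.\<close>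
  define a w :: complex where "a = 1 / of_real (sqrt 6)" and "w = of_real (sqrt 2)"
  have "sqrt 6 = sqrt 2 * sqrt 3"
    by (simp flip: real_sqrt_mult)
  then have b: "1 / of_real (sqrt 3) = w * a"
    by (simp add: a_def w_def)
  have sixth: "1 / 6 = a * a"
    by (simp add: a_def flip: of_real_mult)
  have w: "w * w = 2"
    by (simp add: w_def flip: of_real_mult)
  then have "w \<noteq> 0"
    by auto
  \<comment> \<open>From \<open>w * w = 2\<close> one gets 1 / w = w / 2, hence 1 / (3 w) = w /
    6.\<close>
  then have m: "1 / (3 * w) = w * (a * a)"
    using w unfolding sixth[symmetric] by (simp add: field_simps)
  \<comment> \<open>Eliminating the conjugate and all higher powers leaves only 1 and
    \<open>q3\<close>, which gives a normal form for the coefficients.\<close>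
  have c: "cnj q3 = - 1 - q3"
    using q3_sum by (simp add: algebra_simps eq_neg_iff_add_eq_0)
  have q: "q3 * q3 = - 1 - q3"
    using q3_mult(3) c by simp
  \<comment> \<open>Normalised products are nested to the right, so the two relations must also fire
    when further factors follow.\<close>
  have wx: "w * (w * x) = 2 * x" and qx: "q3 * (q3 * x) = - x - q3 * x" for x
    by (simp_all add: w q left_diff_distrib flip: mult.assoc)
  note entries = hyp_as_multiples[folded a_def, unfolded b]
  \<comment> \<open>With the scalars of the claim written through \<open>a * a\<close>, the constant
    \<open>a\<close> can stay an indeterminate in both computations.\<close>
  have q_third: "q3 / 3 = 2 * q3 * (a * a)" and q_sixth: "q3 / 6 = q3 * (a * a)"
    by (simp_all flip: sixth)
  have "\<forall>p. H $ p $ p = 2 * q3 * (a * a) * K u v"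
    by (simp add: H forall_3 sum_3 entries K_def c algebra_simps w q wx qx)
  then show "H $ p $ p = q3 / 3 * K u v"
    unfolding q_third by blast
  have "\<forall>p k. p \<noteq> k \<longrightarrow> H $ p $ k =
           q3 * (a * a) * det2 (first3 u $ k) (first3 u $ p) (first3 v $ k) (first3 v $ p)
           + w * (a * a) * (\<Sum>r\<in>UNIV. tau $ p $ k $ r * det2 (first3 u $ r) (u $ 4) (first3 v $ r) (v $ 4))
           + w * (a * a) * (\<Sum>r\<in>UNIV. cnj (tau $ p $ k $ r) * det2 (first3 u $ r) (u $ 5) (first3 v $ r) (v $ 5))"
    by (simp add: H forall_3 sum_3 entries tau_def det2_def det_2 first3_def c algebra_simps w q wx qx)
  then show "p \<noteq> k \<Longrightarrow> H $ p $ k =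
           q3 / 6 * det2 (first3 u $ k) (first3 u $ p) (first3 v $ k) (first3 v $ p)
           + 1 / (3 * of_real (sqrt 2)) *
             (\<Sum>r\<in>UNIV. tau $ p $ k $ r * det2 (first3 u $ r) (u $ 4) (first3 v $ r) (v $ 4))
           + 1 / (3 * of_real (sqrt 2)) *
             (\<Sum>r\<in>UNIV. cnj (tau $ p $ k $ r) * det2 (first3 u $ r) (u $ 5) (first3 v $ r) (v $ 5))"
    unfolding q_sixth m[unfolded w_def] w_def by blast
qed

text \<open>The six nonzero entries pair up with opposite signs: 123 with 213, 231 with 321, 312
  with 132.\<close>

lemma tau_swap: "tau $ k $ p $ r = - tau $ p $ k $ r"
proof -
  have "\<forall>p k r. tau $ k $ p $ r = - tau $ p $ k $ r"
    by (simp add: tau_def forall_3)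
  then show ?thesis by blast
qed

lemma det2_swap_columns: "det2 b a d c = - det2 a b c d"
  by (simp add: det2_def det_2)

theorem mainTheorem2:
  fixes T U V :: "complex ^ 3 ^ 3 ^ 3"
    and u v :: "complex ^ 5"
    and H :: "complex ^ 3 ^ 3"
  assumes "U = hyp u" and "V = hyp v"
    and "H = (\<chi> p k. \<Sum>r\<in>UNIV. \<Sum>s\<in>UNIV. U $ r $ s $ p * V $ s $ r $ k)"
  shows "(\<forall>i j k. hmult T U V $ i $ j $ k = (\<Sum>p\<in>UNIV. T $ i $ j $ p * H $ p $ k))
    \<and> (\<forall>p. H $ p $ p = q3 / 3 * K u v)
    \<and> (\<forall>p k. p \<noteq> k \<longrightarrow>
         H $ p $ k =
           q3 / 6 * det2 (first3 u $ k) (first3 u $ p) (first3 v $ k) (first3 v $ p)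
           + 1 / (3 * of_real (sqrt 2)) *
             (\<Sum>r\<in>UNIV. tau $ p $ k $ r * det2 (first3 u $ r) (u $ 4) (first3 v $ r) (v $ 4))
           + 1 / (3 * of_real (sqrt 2)) *
             (\<Sum>r\<in>UNIV. cnj (tau $ p $ k $ r) * det2 (first3 u $ r) (u $ 5) (first3 v $ r) (v $ 5)))
    \<and> (\<forall>p k. p \<noteq> k \<longrightarrow> H $ p $ k = - H $ k $ p)
    \<and> sym_part H = diag_part H
    \<and> diag_part H = mat (q3 / 3 * K u v)
    \<and> skew_part H = offdiag_part H"
proof -
  have H: "H = (\<chi> p k. \<Sum>r\<in>UNIV. \<Sum>s\<in>UNIV. hyp u $ r $ s $ p * hyp v $ s $ r $ k)"
    using assms by simp
  note diag = slice_product_entries(1)[OF H] and offdiag = slice_product_entries(2)[OF H]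
  have prod: "hmult T U V $ i $ j $ k = (\<Sum>p\<in>UNIV. T $ i $ j $ p * H $ p $ k)" for i j k
    by (simp add: hmult_def assms(3) sum_distrib_left mult.assoc)
  \<comment> \<open>Under exchange of \<open>p\<close> and \<open>k\<close> the first determinant
    changes sign by its columns, and both sums change sign through \<open>tau\<close>. Fixed
    instances keep the rewriting in one direction.\<close>
  have skew: "H $ p $ k = - H $ k $ p" if "p \<noteq> k" for p k
    using that
    by (simp add: offdiag tau_swap[of k p] det2_swap_columns[of "first3 u $ p" "first3 u $ k"]
        sum_negf algebra_simps)
  \<comment> \<open>Off the diagonal the two summands cancel; on it the factor 1 / 2 undoes the
    doubling. For the skew part the roles are exchanged.\<close>
  have "sym_part H $ p $ k = diag_part H $ p $ k" for p k
    using skew[of p k] by (auto simp: sym_part_def diag_part_def transpose_def)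
  moreover have "diag_part H = mat (q3 / 3 * K u v)"
    by (simp add: diag_part_def mat_def vec_eq_iff diag)
  moreover have "skew_part H $ p $ k = offdiag_part H $ p $ k" for p k
    using skew[of k p] by (auto simp: skew_part_def offdiag_part_def transpose_def)
  ultimately show ?thesis
    using prod diag offdiag skew unfolding vec_eq_iff by blast
qed

end
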